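(* Let $n \geq 4$ be an integer. Then $\mu(W(D_n)) = 2n$.
   Context: For a finite group $G$, $\mu(G)$ denotes the minimal faithful permutation degree of $G$: the least non-negative integer $m$ such that $G$ embeds in the symmetric group $\mathrm{Sym}(m)$. $W(D_n)$ denotes the Coxeter group of type $D_n$. Concretely, let $U=\{(a_1,\dots,a_n)\in \mathbb{F}_2^n : \sum_{i=1}^n a_i=0\}$, with $\mathrm{Sym}(n)$ acting by permuting coordinates; then $W(D_n)= U\rtimes \mathrm{Sym}(n)$. Equivalently, it is the group of even signed permutations of $\{\pm1,\dots,\pm n\}$ (signed permutations with an even number of sign changes), a subgroup of index $2$ in $W(B_n)=C_2\wr \mathrm{Sym}(n)$. *)

theory Defs
  imports "HOL-Algebra.Sym_Groups" "HOL-Library.Z2"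
begin

(* For finite G the minimum exists by Cayley's theorem; for infinite G the value is unspecified. *)
definition min_faithful_perm_degree :: "('a, 'b) monoid_scheme \<Rightarrow> nat"
  where "min_faithful_perm_degree G = (LEAST m. mon G (sym_group m) \<noteq> {})"

definition semidirect_product ::
  "('a, 'c) monoid_scheme \<Rightarrow> ('b, 'd) monoid_scheme \<Rightarrow> ('b \<Rightarrow> 'a \<Rightarrow> 'a) \<Rightarrow> ('a \<times> 'b) monoid"
  where "semidirect_product N H \<phi> =
    \<lparr> carrier = carrier N \<times> carrier H,
      mult = (\<lambda>(a, s) (b, t). (a \<otimes>\<^bsub>N\<^esub> \<phi> s b, s \<otimes>\<^bsub>H\<^esub> t)),
      one = (\<one>\<^bsub>N\<^esub>, \<one>\<^bsub>H\<^esub>) \<rparr>"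

(* Vectors of F_2^n are functions vanishing outside {1..n}; bit is the field F_2. *)
definition even_vectors :: "nat \<Rightarrow> (nat \<Rightarrow> bit) monoid"
  where "even_vectors n =
    \<lparr> carrier = {a. (\<forall>i. i \<notin> {1..n} \<longrightarrow> a i = 0) \<and> (\<Sum>i=1..n. a i) = 0},
      mult = (\<lambda>a b i. a i + b i),
      one = (\<lambda>i. 0) \<rparr>"

(* The inverse makes this a left action: it sends the i-th basis vector to the (s i)-th one. *)
definition permute_coords :: "(nat \<Rightarrow> nat) \<Rightarrow> (nat \<Rightarrow> bit) \<Rightarrow> (nat \<Rightarrow> bit)"
  where "permute_coords s a = a \<circ> inv' s"

definition coxeter_D :: "nat \<Rightarrow> ((nat \<Rightarrow> bit) \<times> (nat \<Rightarrow> nat)) monoid"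
  where "coxeter_D n = semidirect_product (even_vectors n) (sym_group n) permute_coords"

lemma group_even_vectors: "group (even_vectors n)"
proof (rule groupI)
  fix a assume a: "a \<in> carrier (even_vectors n)"
  show "\<exists>b\<in>carrier (even_vectors n). b \<otimes>\<^bsub>even_vectors n\<^esub> a = \<one>\<^bsub>even_vectors n\<^esub>"
    using a by (intro bexI[of _ a]) (auto simp: even_vectors_def)
qed (auto simp: even_vectors_def sum.distrib add.assoc simp del: add_bit_eq_xor)

lemma permute_coords_closed:
  assumes s: "s permutes {1..n}" and a: "a \<in> carrier (even_vectors n)"
  shows "permute_coords s a \<in> carrier (even_vectors n)"
proof -
  have s': "inv' s permutes {1..n}" using s by (rule permutes_inv)
  have "(\<Sum>i=1..n. a (inv' s i)) = (\<Sum>i=1..n. a i)"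
    using sum.permute[OF s', of a] by (simp add: comp_def)
  moreover have "a (inv' s i) = 0" if "i \<notin> {1..n}" for i
    using that a permutes_not_in[OF s' that] by (simp add: even_vectors_def)
  ultimately show ?thesis
    using a by (auto simp: even_vectors_def permute_coords_def)
qed

lemma permute_coords_comp:
  assumes "s permutes {1..n}" "t permutes {1..n}"
  shows "permute_coords (s \<circ> t) a = permute_coords s (permute_coords t a)"
  using assms by (simp add: permute_coords_def o_inv_distrib permutes_bij o_assoc)

lemma group_coxeter_D: "group (coxeter_D n)"
proof (rule groupI)
  fix x assume "x \<in> carrier (coxeter_D n)"
  then obtain a s where x: "x = (a, s)" "a \<in> carrier (even_vectors n)" "s permutes {1..n}"
    by (auto simp: coxeter_D_def semidirect_product_def sym_group_def)
  have "inv' s permutes {1..n}" using x by (simp add: permutes_inv)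
  with x show "\<exists>y\<in>carrier (coxeter_D n). y \<otimes>\<^bsub>coxeter_D n\<^esub> x = \<one>\<^bsub>coxeter_D n\<^esub>"
    using permute_coords_closed[of "inv' s" n a]
    by (intro bexI[of _ "(permute_coords (inv' s) a, inv' s)"])
       (auto simp: coxeter_D_def semidirect_product_def sym_group_def even_vectors_def
         permutes_inv_o)
next
  fix x y assume "x \<in> carrier (coxeter_D n)" "y \<in> carrier (coxeter_D n)"
  then show "x \<otimes>\<^bsub>coxeter_D n\<^esub> y \<in> carrier (coxeter_D n)"
    using permute_coords_closed group.is_monoid[OF group_even_vectors[of n]]
    by (auto simp: coxeter_D_def semidirect_product_def sym_group_def
        intro!: monoid.m_closed permutes_compose)
next
  fix x y z
  assume "x \<in> carrier (coxeter_D n)" "y \<in> carrier (coxeter_D n)" "z \<in> carrier (coxeter_D n)"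
  then show "x \<otimes>\<^bsub>coxeter_D n\<^esub> y \<otimes>\<^bsub>coxeter_D n\<^esub> z = x \<otimes>\<^bsub>coxeter_D n\<^esub> (y \<otimes>\<^bsub>coxeter_D n\<^esub> z)"
    by (auto simp: coxeter_D_def semidirect_product_def sym_group_def even_vectors_def
        permute_coords_comp o_assoc simp del: add_bit_eq_xor) (auto simp: permute_coords_def add.assoc simp del: add_bit_eq_xor)
next
  show "\<one>\<^bsub>coxeter_D n\<^esub> \<in> carrier (coxeter_D n)"
    by (auto simp: coxeter_D_def semidirect_product_def sym_group_def even_vectors_def permutes_id)
next
  fix x assume "x \<in> carrier (coxeter_D n)"
  then show "\<one>\<^bsub>coxeter_D n\<^esub> \<otimes>\<^bsub>coxeter_D n\<^esub> x = x"
    by (auto simp: coxeter_D_def semidirect_product_def sym_group_def even_vectors_def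
        permute_coords_def)
qed

end

theory Submission
  imports Defs Complex_Main
begin

text \<open>
  The upper bound is the action of even signed permutations on the \<open>2n\<close> points
  \<open>\<plusminus>1, \<dots>, \<plusminus>n\<close> (\<open>signed_perm_mon\<close>).

  For the lower bound, let \<open>W(D\<^sub>n)\<close> act faithfully on \<open>m\<close> points and consider the real functions
  on these points that are simultaneous eigenvectors of the even vectors \<open>U\<close>. The eigencharacters
  are the sign characters \<open>a \<mapsto> (-1)^(\<Sum>i\<in>S. a i)\<close> of subsets \<open>S\<close> of \<open>{1..n}\<close>, where \<open>S\<close> and its
  complement give the same character of \<open>U\<close>. Call \<open>S\<close> a weight if it occurs with a nonzero
  function. Four properties decide everything:

  \<^item> Some weight is neither empty nor full, as \<open>U\<close> acts nontrivially (\<open>ex_nontrivial_weight\<close>).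
  \<^item> Weights depend only on their size, up to complement: \<open>Sym(n)\<close> permutes them
    (\<open>weight_of_same_card\<close>, \<open>weight_compl\<close>). So there is a weight of size \<open>k\<close> with
    \<open>1 \<le> k \<le> n/2\<close>.
  \<^item> Eigenfunctions with different characters are orthogonal, so there are at most \<open>m\<close>
    weights up to complement (\<open>card_weights_le\<close>).
  \<^item> Pointwise products multiply characters, that is, they send weights \<open>S\<close> and \<open>T\<close> to their
    symmetric difference (\<open>weight_function_mult\<close>).

  If \<open>k = 2\<close>, then all the \<open>n choose 2 \<ge> 2n\<close> pairs are weights. If \<open>k \<ge> 3\<close>, the \<open>k\<close>-sets that contain
  \<open>1\<close> are at least \<open>(n - 1) choose 2 \<ge> 2n\<close> weights, no two of them complementary. If \<open>k = 1\<close>, take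
  an eigenfunction for each singleton. If two of them overlap somewhere, their product makes a
  pair a weight, which is the case \<open>k = 2\<close>. Otherwise they have \<open>n\<close> disjoint supports, each with at
  least two points since an element of \<open>U\<close> flips the sign of the function.

  The counts need \<open>n = 5\<close>, where \<open>k \<ge> 3\<close> cannot happen, or \<open>n \<ge> 7\<close>. For \<open>n = 4\<close> and \<open>n = 6\<close>, the order
  \<open>2^(n-1) * n!\<close> does not divide \<open>(2n-1)!\<close>, and Lagrange's theorem excludes \<open>m < 2n\<close>.
\<close>

section \<open>Coordinates in the group\<close>

text \<open>
  Bits are used below as elements of an additive group, so their sums should not be rewritten
  into propositional form.
\<close>
declare add_bit_eq_xor [simp del]

lemma coxeter_D_carrier [simp]:
  "(a, s) \<in> carrier (coxeter_D n) \<longleftrightarrow> a \<in> carrier (even_vectors n) \<and> s permutes {1..n}"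
  by (simp add: coxeter_D_def semidirect_product_def sym_group_def)

lemma coxeter_D_mult [simp]:
  "(a, s) \<otimes>\<^bsub>coxeter_D n\<^esub> (b, t) = (\<lambda>i. a i + b (inv' s i), s \<circ> t)"
  by (simp add: coxeter_D_def semidirect_product_def sym_group_def even_vectors_def
      permute_coords_def)

lemma coxeter_D_one: "\<one>\<^bsub>coxeter_D n\<^esub> = (\<lambda>i. 0, id)"
  by (simp add: coxeter_D_def semidirect_product_def sym_group_def even_vectors_def)

lemma even_vectors_zero [simp]: "(\<lambda>i. 0) \<in> carrier (even_vectors n)"
  by (simp add: even_vectors_def)

lemma even_vectors_add:
  assumes "a \<in> carrier (even_vectors n)" "b \<in> carrier (even_vectors n)"
  shows "(\<lambda>i. a i + b i) \<in> carrier (even_vectors n)"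
  using monoid.m_closed[OF group.is_monoid[OF group_even_vectors] assms]
  by (simp add: even_vectors_def)

lemma coxeter_D_cases:
  assumes "x \<in> carrier (coxeter_D n)"
  obtains a s where "x = (a, s)" "a \<in> carrier (even_vectors n)" "s permutes {1..n}"
  using assms by (cases x) auto

lemma sum_bit_indicator: "finite A \<Longrightarrow> (\<Sum>i\<in>A. if i \<in> X then 1 else 0 :: bit) = of_nat (card (A \<inter> X))"
  by (simp add: sum.If_cases)

lemma pair_in_even_vectors:
  assumes "i \<in> {1..n}" "j \<in> {1..n}" "i \<noteq> j"
  shows "(\<lambda>k. if k \<in> {i, j} then 1 else 0) \<in> carrier (even_vectors n)"
proof -
  have "{1..n} \<inter> {i, j} = {i, j}" using assms by auto
  with assms show ?thesis
    by (simp add: even_vectors_def sum_bit_indicator del: insert_iff) auto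
qed

lemma card_even_vectors:
  assumes "n \<ge> 1"
  shows "card (carrier (even_vectors n)) = 2 ^ (n - 1)"
proof -
  \<comment> \<open>The entries in \<open>{2..n}\<close> are free and the first one is the parity bit.\<close>
  define v :: "nat set \<Rightarrow> nat \<Rightarrow> bit" where
    "v X = (\<lambda>i. if i = 1 then of_nat (card X) else if i \<in> X then 1 else 0)" for X
  have split: "{1..n} = insert 1 {2..n}" using assms by auto
  have tail: "(\<Sum>i\<in>{1..n}. a i) = a 1 + (\<Sum>i\<in>{2..n}. a i)" for a :: "nat \<Rightarrow> bit"
    unfolding split by (rule sum.insert) auto
  have sum_v: "(\<Sum>i\<in>{2..n}. v X i) = of_nat (card X)" if "X \<subseteq> {2..n}" for X
  proof -
    have "(\<Sum>i\<in>{2..n}. v X i) = (\<Sum>i\<in>{2..n}. if i \<in> X then 1 else 0)"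
      by (intro sum.cong) (auto simp: v_def)
    also have "\<dots> = of_nat (card X)" using that by (simp only: sum_bit_indicator finite_atLeastAtMost Int_absorb1)
    finally show ?thesis .
  qed
  have "bij_betw v (Pow {2..n}) (carrier (even_vectors n))"
  proof (rule bij_betw_byWitness[where f' = "\<lambda>a. {i \<in> {2..n}. a i = 1}"])
    show "\<forall>X\<in>Pow {2..n}. {i \<in> {2..n}. v X i = 1} = X" by (auto simp: v_def)
    show v: "v ` Pow {2..n} \<subseteq> carrier (even_vectors n)"
    proof clarify
      fix X assume X: "X \<subseteq> {2..n}"
      have "v X 1 = of_nat (card X)" by (simp add: v_def)
      then have "(\<Sum>i\<in>{1..n}. v X i) = 0" by (simp only: tail sum_v[OF X]) simp
      then show "v X \<in> carrier (even_vectors n)"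
        using X assms by (auto simp: even_vectors_def v_def)
    qed
    show "\<forall>a\<in>carrier (even_vectors n). v {i \<in> {2..n}. a i = 1} = a"
    proof
      fix a assume a: "a \<in> carrier (even_vectors n)"
      let ?X = "{i \<in> {2..n}. a i = 1}"
      have eq: "v ?X i = a i" if "i \<noteq> 1" for i
      proof (cases "i \<in> {2..n}")
        case False
        with that have "i \<notin> {1..n}" by auto
        with a False that show ?thesis by (simp add: v_def even_vectors_def)
      qed (use that in \<open>cases "a i"; simp add: v_def\<close>)
      have "a 1 = (\<Sum>i\<in>{2..n}. a i)"
        using a tail[of a] by (cases "a 1"; cases "\<Sum>i\<in>{2..n}. a i") (auto simp: even_vectors_def)
      also have "\<dots> = (\<Sum>i\<in>{2..n}. v ?X i)" by (intro sum.cong refl eq[symmetric]) auto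
      also have "\<dots> = v ?X 1" by (subst sum_v) (auto simp: v_def)
      finally have "v ?X 1 = a 1" ..
      show "v ?X = a"
      proof
        show "v ?X i = a i" for i using eq[of i] \<open>v ?X 1 = a 1\<close> by (cases "i = 1") simp_all
      qed
    qed
  qed blast
  from bij_betw_same_card[OF this] show ?thesis by (simp add: card_Pow)
qed

lemma order_coxeter_D:
  assumes "n \<ge> 1"
  shows "order (coxeter_D n) = 2 ^ (n - 1) * fact n"
  using card_even_vectors[OF assms] sym_group_card_carrier[of n]
  by (simp add: order_def coxeter_D_def semidirect_product_def card_cartesian_product)

section \<open>The signed permutation representation of degree 2n\<close>

text \<open>
  The points \<open>i\<close> and \<open>i + n\<close>, for \<open>i \<in> {1..n}\<close>, stand for \<open>+i\<close> and \<open>-i\<close>. The sign is read off at \<open>s i\<close>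
  rather than at \<open>i\<close> because in \<open>(a, s)\<close> the vector acts after the permutation.
\<close>
definition signed_perm :: "nat \<Rightarrow> (nat \<Rightarrow> bit) \<times> (nat \<Rightarrow> nat) \<Rightarrow> nat \<Rightarrow> nat"
  where "signed_perm n = (\<lambda>(a, s) x.
    if x \<in> {1..n} then (if a (s x) = 0 then s x else s x + n)
    else if x \<in> {n+1..2*n} then (if a (s (x - n)) = 0 then s (x - n) + n else s (x - n))
    else x)"

lemma signed_perm_lower:
  "i \<in> {1..n} \<Longrightarrow> signed_perm n (a, s) i = (if a (s i) = 0 then s i else s i + n)"
  by (simp add: signed_perm_def)

lemma signed_perm_upper:
  "i \<in> {1..n} \<Longrightarrow> signed_perm n (a, s) (i + n) = (if a (s i) = 0 then s i + n else s i)"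
  by (simp add: signed_perm_def)

lemma signed_perm_outside: "k \<notin> {1..2*n} \<Longrightarrow> signed_perm n x k = k"
  by (cases x) (auto simp: signed_perm_def)

lemma signed_points_cases:
  obtains (lower) "k \<in> {1..n}" | (upper) i where "i \<in> {1..n}" "k = i + n"
    | (outside) "k \<notin> {1..2*n :: nat}"
proof (cases "n < k \<and> k \<le> 2 * n")
  case True
  then have "k - n \<in> {1..n}" "k = k - n + n" by auto
  then show thesis by (rule upper)
qed (use lower outside in force)

lemma signed_perm_mult:
  assumes "x \<in> carrier (coxeter_D n)" "y \<in> carrier (coxeter_D n)"
  shows "signed_perm n (x \<otimes>\<^bsub>coxeter_D n\<^esub> y) = signed_perm n x \<circ> signed_perm n y"
proof
  fix k
  obtain a s where x: "x = (a, s)" and s: "s permutes {1..n}"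
    using assms(1) by (rule coxeter_D_cases)
  obtain b t where y: "y = (b, t)" and t: "t permutes {1..n}"
    using assms(2) by (rule coxeter_D_cases)
  have inv: "inv' s (s i) = i" for i
    using s by (simp add: permutes_inverses)
  have T: "t i \<in> {1..n}" if "i \<in> {1..n}" for i
    using that t by (simp only: permutes_in_image)
  note eval = signed_perm_lower signed_perm_upper signed_perm_outside
  show "signed_perm n (x \<otimes>\<^bsub>coxeter_D n\<^esub> y) k = (signed_perm n x \<circ> signed_perm n y) k"
  proof (cases k n rule: signed_points_cases)
    case lower
    then show ?thesis
      by (cases "a (s (t k))"; cases "b (t k)")
        (simp_all add: x y inv eval T del: atLeastAtMost_iff One_nat_def)
  next
    case (upper i)
    then show ?thesis
      by (cases "a (s (t i))"; cases "b (t i)")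
        (simp_all add: x y inv eval T del: atLeastAtMost_iff One_nat_def)
  next
    case outside
    then show ?thesis by (simp add: eval del: atLeastAtMost_iff One_nat_def)
  qed
qed

lemma signed_perm_in_range:
  assumes "x \<in> carrier (coxeter_D n)" "k \<in> {1..2*n}"
  shows "signed_perm n x k \<in> {1..2*n}"
proof -
  obtain a s where x: "x = (a, s)" and s: "s permutes {1..n}"
    using assms(1) by (rule coxeter_D_cases)
  have S: "s i \<in> {1..n}" if "i \<in> {1..n}" for i
    using that s by (simp only: permutes_in_image)
  show ?thesis
  proof (cases k n rule: signed_points_cases)
    case lower
    with S[OF lower] show ?thesis by (simp add: x signed_perm_lower)
  next
    case (upper i)
    with S[OF upper(1)] show ?thesis by (simp add: x signed_perm_upper)
  qed (use assms(2) in simp)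
qed

lemma signed_perm_permutes:
  assumes "x \<in> carrier (coxeter_D n)"
  shows "signed_perm n x permutes {1..2*n}"
proof (rule bij_imp_permutes)
  interpret group "coxeter_D n" by (rule group_coxeter_D)
  let ?y = "inv\<^bsub>coxeter_D n\<^esub> x"
  have one: "signed_perm n \<one>\<^bsub>coxeter_D n\<^esub> = id"
    by (auto simp: coxeter_D_one signed_perm_def fun_eq_iff)
  have xy: "signed_perm n x (signed_perm n ?y k) = k" "signed_perm n ?y (signed_perm n x k) = k" for k
    using signed_perm_mult[of x n ?y] signed_perm_mult[of ?y n x] assms one
    by (auto simp: fun_eq_iff)
  show "bij_betw (signed_perm n x) {1..2*n} {1..2*n}"
    using signed_perm_in_range[OF assms] signed_perm_in_range[of ?y n] assms
    by (intro bij_betw_byWitness[where f' = "signed_perm n ?y"]) (auto simp only: xy inv_closed)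
  show "signed_perm n x k = k" if "k \<notin> {1..2*n}" for k
    using that by (rule signed_perm_outside)
qed

lemma signed_perm_mon: "signed_perm n \<in> mon (coxeter_D n) (sym_group (2 * n))"
proof -
  have "inj_on (signed_perm n) (carrier (coxeter_D n))"
  proof (rule inj_onI)
    fix x y assume x: "x \<in> carrier (coxeter_D n)" and y: "y \<in> carrier (coxeter_D n)"
      and eq: "signed_perm n x = signed_perm n y"
    obtain a s where x: "x = (a, s)" "a \<in> carrier (even_vectors n)" "s permutes {1..n}"
      using x by (rule coxeter_D_cases)
    obtain b t where y: "y = (b, t)" "b \<in> carrier (even_vectors n)" "t permutes {1..n}"
      using y by (rule coxeter_D_cases)
    have st: "s i = t i \<and> a (s i) = b (s i)" if i: "i \<in> {1..n}" for i
    proof -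
      have "s i \<in> {1..n}" "t i \<in> {1..n}" using i x(3) y(3) by (simp_all only: permutes_in_image)
      with i show ?thesis
        using fun_cong[OF eq, of i]
        by (cases "a (s i)"; cases "b (t i)") (auto simp: x y signed_perm_lower)
    qed
    have "s = t"
      using st x(3) y(3) by (metis ext permutes_not_in)
    moreover have "a = b"
    proof
      fix j
      show "a j = b j"
      proof (cases "j \<in> {1..n}")
        case True
        then obtain i where "i \<in> {1..n}" "j = s i"
          using permutes_image[OF x(3)] by blast
        with st[of i] show ?thesis by metis
      next
        case False
        then show ?thesis using x(2) y(2) by (simp add: even_vectors_def)
      qed
    qed
    ultimately show "x = y" by (simp add: x y)
  qed
  then show ?thesis
    by (auto simp only: mon_def mem_Collect_eq sym_group_carrier sym_group_mult
        intro!: homI signed_perm_permutes signed_perm_mult)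
qed

section \<open>Characters of the even vectors\<close>

definition sign_char :: "nat set \<Rightarrow> (nat \<Rightarrow> bit) \<Rightarrow> real"
  where "sign_char S a = (\<Prod>i\<in>S. if a i = 0 then 1 else -1)"

lemma sign_char_add: "sign_char S (\<lambda>i. a i + b i) = sign_char S a * sign_char S b"
proof -
  have "(if a i + b i = 0 then 1 else -1 :: real) =
      (if a i = 0 then 1 else -1) * (if b i = 0 then 1 else -1)" for i
    by (cases "a i"; cases "b i") auto
  then show ?thesis by (simp add: sign_char_def prod.distrib)
qed

lemma sign_char_square [simp]: "sign_char S a * sign_char S a = 1"
  by (simp add: sign_char_def flip: prod.distrib) (simp add: prod.neutral)

lemma sign_char_sym_diff:
  assumes "finite S" "finite T"
  shows "sign_char (sym_diff S T) a = sign_char S a * sign_char T a"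
proof -
  have ST: "S = (S - T) \<union> (S \<inter> T)" "T = (T - S) \<union> (S \<inter> T)" by auto
  have S: "sign_char S a = sign_char (S - T) a * sign_char (S \<inter> T) a"
    unfolding sign_char_def using assms by (subst ST(1), subst prod.union_disjoint) auto
  have T: "sign_char T a = sign_char (T - S) a * sign_char (S \<inter> T) a"
    unfolding sign_char_def using assms by (subst ST(2), subst prod.union_disjoint) auto
  have "sign_char (sym_diff S T) a = sign_char (S - T) a * sign_char (T - S) a"
    unfolding sign_char_def using assms by (subst prod.union_disjoint) auto
  with S T show ?thesis
    by (simp add: mult.assoc mult.left_commute[of "sign_char (S \<inter> T) a"])
qed

text \<open>
  The entries of an even vector sum to \<open>0\<close>. This is why complementary sets have the same
  character on \<open>U\<close>, and why weights are counted up to complement.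
\<close>
lemma sign_char_top:
  assumes "a \<in> carrier (even_vectors n)"
  shows "sign_char {1..n} a = 1"
proof -
  have "finite A \<Longrightarrow> (\<Prod>i\<in>A. if a i = 0 then 1 else -1 :: real) = (if (\<Sum>i\<in>A. a i) = 0 then 1 else -1)"
    for A
  proof (induction rule: finite_induct)
    case (insert x F)
    then show ?case by (cases "a x"; cases "sum a F") auto
  qed simp
  with assms show ?thesis by (simp add: sign_char_def even_vectors_def)
qed

lemma sign_char_compl:
  assumes "S \<subseteq> {1..n}" "a \<in> carrier (even_vectors n)"
  shows "sign_char ({1..n} - S) a = sign_char S a"
proof -
  have "sym_diff {1..n} S = {1..n} - S" using assms(1) by blast
  then show ?thesis
    using sign_char_sym_diff[of "{1..n}" S a] finite_subset[OF assms(1)] sign_char_top[OF assms(2)]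
    by simp
qed

lemma sign_char_image:
  assumes "s permutes A"
  shows "sign_char (s ` S) a = sign_char S (\<lambda>i. a (s i))"
  unfolding sign_char_def
  by (subst prod.reindex) (auto intro: inj_on_subset[OF permutes_inj[OF assms]])

text \<open>
  Flip one coordinate inside \<open>S\<close> and one outside; a proper nonempty \<open>S\<close> has both.
\<close>
lemma sign_char_nontrivial:
  assumes "S \<subseteq> {1..n}" "S \<noteq> {}" "S \<noteq> {1..n}"
  obtains a where "a \<in> carrier (even_vectors n)" "sign_char S a = -1"
proof -
  obtain i where i: "i \<in> S" using assms by blast
  obtain j where j: "j \<in> {1..n}" "j \<notin> S" using assms by blast
  let ?a = "\<lambda>k. if k \<in> {i, j} then 1 else 0 :: bit"
  have fin: "finite S" using assms(1) finite_subset by blast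
  have "sign_char S ?a = (\<Prod>k\<in>S. if k = i then -1 else 1)"
    unfolding sign_char_def using j by (intro prod.cong) auto
  also have "\<dots> = -1" using fin i by (simp add: prod.delta)
  finally show thesis
    using that[of ?a] pair_in_even_vectors[of i n j] i j assms(1) by blast
qed

text \<open>
  Fourier inversion at the origin: the sum factors as \<open>\<Prod>i. (1 + (-1)^(a i))\<close>, in which any
  nonzero entry of \<open>a\<close> kills a factor.
\<close>
lemma sum_sign_char:
  assumes "a \<in> carrier (even_vectors n)"
  shows "(\<Sum>S\<in>Pow {1..n}. sign_char S a) = (if a = (\<lambda>i. 0) then 2 ^ n else 0)"
proof -
  have "(\<Sum>S\<in>Pow {1..n}. sign_char S a) = (\<Prod>i\<in>{1..n}. (if a i = 0 then 1 else -1) + 1)"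
    unfolding sign_char_def by (subst prod_add) simp_all
  also have "\<dots> = (if a = (\<lambda>i. 0) then 2 ^ n else 0)"
  proof (cases "a = (\<lambda>i. 0)")
    case False
    then obtain i where "a i \<noteq> 0" by (auto simp only: fun_eq_iff)
    with assms have "i \<in> {1..n}" by (auto simp: even_vectors_def)
    with \<open>a i \<noteq> 0\<close> show ?thesis using False by (simp add: prod_zero_iff) force
  qed simp
  finally show ?thesis .
qed

section \<open>Orthogonal families of functions on a finite set\<close>

text \<open>
  The dimension bound for orthogonal families, by Bessel's inequality: after normalization
  \<open>\<Sum>i. (g i y)\<^sup>2 \<le> 1\<close> at each point \<open>y\<close>, and the sum over all \<open>y\<close> counts the family.
\<close>
lemma card_orthogonal_family_le:
  fixes f :: "'i \<Rightarrow> 'x \<Rightarrow> real"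
  assumes "finite I" "finite X"
    and nz: "\<And>i. i \<in> I \<Longrightarrow> \<exists>x\<in>X. f i x \<noteq> 0"
    and orth: "\<And>i j. i \<in> I \<Longrightarrow> j \<in> I \<Longrightarrow> i \<noteq> j \<Longrightarrow> (\<Sum>x\<in>X. f i x * f j x) = 0"
  shows "card I \<le> card X"
proof -
  define N where "N i = (\<Sum>x\<in>X. f i x * f i x)" for i
  define g where "g i x = f i x / sqrt (N i)" for i x
  have N: "N i > 0" if i: "i \<in> I" for i
  proof -
    obtain x where "x \<in> X" "f i x \<noteq> 0" using nz i by blast
    then have "0 < f i x * f i x" by (metis not_real_square_gt_zero)
    also have "\<dots> \<le> N i" unfolding N_def
      by (rule member_le_sum) (use \<open>x \<in> X\<close> assms(2) in auto)
    finally show ?thesis .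
  qed
  have on: "(\<Sum>x\<in>X. g i x * g j x) = (if i = j then 1 else 0)" if ij: "i \<in> I" "j \<in> I" for i j
  proof -
    have "(\<Sum>x\<in>X. g i x * g j x) = (\<Sum>x\<in>X. f i x * f j x) / (sqrt (N i) * sqrt (N j))"
      by (simp add: g_def sum_divide_distrib)
    also have "\<dots> = (if i = j then 1 else 0)"
      using orth[OF ij] N[OF ij(1)] by (auto simp: N_def[symmetric])
    finally show ?thesis .
  qed
  have bessel: "(\<Sum>i\<in>I. g i y * g i y) \<le> 1" if y: "y \<in> X" for y
  proof -
    \<comment> \<open>The orthogonal projection of the indicator function of \<open>y\<close> to the span of the family.\<close>
    define p where "p x = (\<Sum>i\<in>I. g i y * g i x)" for x
    have "(\<Sum>x\<in>X. p x * p x) = (\<Sum>x\<in>X. \<Sum>i\<in>I. \<Sum>j\<in>I. g i y * g j y * (g i x * g j x))"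
      by (simp add: p_def sum_product mult_ac)
    also have "\<dots> = (\<Sum>i\<in>I. \<Sum>x\<in>X. \<Sum>j\<in>I. g i y * g j y * (g i x * g j x))"
      by (rule sum.swap)
    also have "\<dots> = (\<Sum>i\<in>I. \<Sum>j\<in>I. \<Sum>x\<in>X. g i y * g j y * (g i x * g j x))"
      by (intro sum.cong refl sum.swap)
    also have "\<dots> = (\<Sum>i\<in>I. \<Sum>j\<in>I. g i y * g j y * (if i = j then 1 else 0))"
      by (intro sum.cong refl) (simp add: on flip: sum_distrib_left)
    also have "\<dots> = p y" using assms(1) by (simp add: p_def if_distrib cong: if_cong)
    finally have pp: "(\<Sum>x\<in>X. p x * p x) = p y" .
    have "0 \<le> (\<Sum>x\<in>X. ((if x = y then 1 else 0) - p x) * ((if x = y then 1 else 0) - p x))"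
      by (intro sum_nonneg) simp
    also have "\<dots> = (\<Sum>x\<in>X. (if x = y then 1 - 2 * p x else 0) + p x * p x)"
      by (intro sum.cong refl) (auto simp: algebra_simps)
    also have "\<dots> = 1 - p y"
      using y assms(2) by (simp add: sum.distrib pp sum.delta)
    finally show ?thesis by (simp add: p_def)
  qed
  have "real (card I) = (\<Sum>i\<in>I. \<Sum>x\<in>X. g i x * g i x)"
    by (simp add: on)
  also have "\<dots> = (\<Sum>x\<in>X. \<Sum>i\<in>I. g i x * g i x)"
    by (rule sum.swap)
  also have "\<dots> \<le> (\<Sum>x\<in>X. 1)" by (rule sum_mono) (rule bessel)
  finally show ?thesis by simp
qed

section \<open>Weights of an action\<close>

text \<open>
  Glue a bijection from \<open>S\<close> to \<open>T\<close> with one between the complements.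
\<close>
lemma ex_permutes_image_eq:
  assumes "finite A" "S \<subseteq> A" "T \<subseteq> A" "card S = card T"
  obtains s where "s permutes A" "s ` S = T"
proof -
  have fin: "finite S" "finite T" using assms finite_subset by auto
  obtain g where g: "bij_betw g S T"
    using finite_same_card_bij[OF fin assms(4)] by blast
  have "card (A - S) = card (A - T)"
    using assms fin by (simp add: card_Diff_subset)
  then obtain h where h: "bij_betw h (A - S) (A - T)"
    using finite_same_card_bij[of "A - S" "A - T"] assms(1) by blast
  define s where "s x = (if x \<in> S then g x else if x \<in> A then h x else x)" for x
  have sg: "bij_betw s S T"
    using g by (rule bij_betw_cong[THEN iffD1, rotated]) (simp add: s_def)
  have "bij_betw s (A - S) (A - T)"
    using h by (rule bij_betw_cong[THEN iffD1, rotated]) (simp add: s_def)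
  from bij_betw_combine[OF sg this] have "bij_betw s A A"
    using assms by (simp add: Un_absorb1)
  then have "s permutes A"
    using assms(2) by (intro bij_imp_permutes) (auto simp: s_def)
  with sg show thesis using that by (auto simp: bij_betw_def)
qed

locale coxeter_D_action =
  fixes n m :: nat and \<phi> :: "(nat \<Rightarrow> bit) \<times> (nat \<Rightarrow> nat) \<Rightarrow> nat \<Rightarrow> nat"
  assumes hom: "\<phi> \<in> hom (coxeter_D n) (sym_group m)"
begin

lemma action_permutes: "g \<in> carrier (coxeter_D n) \<Longrightarrow> \<phi> g permutes {1..m}"
  using hom by (auto simp: hom_def sym_group_def)

lemma action_in_range:
  "g \<in> carrier (coxeter_D n) \<Longrightarrow> x \<in> {1..m} \<Longrightarrow> \<phi> g x \<in> {1..m}"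
  by (simp only: permutes_in_image[OF action_permutes])

lemma action_mult:
  "g \<in> carrier (coxeter_D n) \<Longrightarrow> h \<in> carrier (coxeter_D n) \<Longrightarrow>
    \<phi> g (\<phi> h x) = \<phi> (g \<otimes>\<^bsub>coxeter_D n\<^esub> h) x"
  using hom by (auto simp: hom_def sym_group_def)

lemma action_one: "\<phi> (\<lambda>i. 0, id) = id"
  using hom_one[OF hom group_coxeter_D sym_group_is_group]
  by (simp add: coxeter_D_one sym_group_def)

lemma vector_in_carrier: "a \<in> carrier (even_vectors n) \<Longrightarrow> (a, id) \<in> carrier (coxeter_D n)"
  by (simp add: permutes_id)

lemma vector_action_add:
  assumes "a \<in> carrier (even_vectors n)" "b \<in> carrier (even_vectors n)"
  shows "\<phi> (a, id) (\<phi> (b, id) x) = \<phi> (\<lambda>i. a i + b i, id) x"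
  by (subst action_mult[OF vector_in_carrier vector_in_carrier]) (use assms in simp_all)

text \<open>
  Only the values on the points \<open>{1..m}\<close> matter, hence \<open>f\<close> is constrained only there.
\<close>
definition weight_function :: "nat set \<Rightarrow> (nat \<Rightarrow> real) \<Rightarrow> bool"
  where "weight_function S f \<longleftrightarrow> (\<forall>a\<in>carrier (even_vectors n). \<forall>x\<in>{1..m}.
    f (\<phi> (a, id) x) = sign_char S a * f x)"

definition weight :: "nat set \<Rightarrow> bool"
  where "weight S \<longleftrightarrow> S \<subseteq> {1..n} \<and> (\<exists>f. weight_function S f \<and> (\<exists>x\<in>{1..m}. f x \<noteq> 0))"

lemma weight_function_mult:
  assumes "weight_function S f" "weight_function T g" "finite S" "finite T"
  shows "weight_function (sym_diff S T) (\<lambda>x. f x * g x)"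
  using assms by (simp add: weight_function_def sign_char_sym_diff mult_ac)

lemma weight_compl:
  assumes "weight S"
  shows "weight ({1..n} - S)"
  using assms sign_char_compl[of S n] by (auto simp: weight_def weight_function_def)

text \<open>
  Translating an eigenfunction by \<open>s\<close> permutes the coordinates in its character, because
  \<open>s\<close> normalizes \<open>U\<close>: \<open>(0, s\<inverse>)(a, 1) = (s\<inverse>\<cdot>a, 1)(0, s\<inverse>)\<close>.
\<close>
lemma weight_image:
  assumes S: "weight S" and s: "s permutes {1..n}"
  shows "weight (s ` S)"
proof -
  obtain f x where f: "weight_function S f" and x: "x \<in> {1..m}" "f x \<noteq> 0" and sub: "S \<subseteq> {1..n}"
    using S by (auto simp: weight_def)
  let ?t = "(\<lambda>i. 0 :: bit, inv' s)"
  have t: "?t \<in> carrier (coxeter_D n)" using s by (simp add: permutes_inv)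
  define g where "g y = f (\<phi> ?t y)" for y
  have "g (\<phi> (a, id) y) = sign_char (s ` S) a * g y"
    if a: "a \<in> carrier (even_vectors n)" and y: "y \<in> {1..m}" for a y
  proof -
    have inv: "inv' (inv' s) = s" using s by (simp add: permutes_inv_inv)
    have b: "(\<lambda>i. a (s i)) \<in> carrier (even_vectors n)"
      using permute_coords_closed[OF permutes_inv[OF s] a]
      by (simp add: permute_coords_def inv comp_def)
    have "\<phi> ?t (\<phi> (a, id) y) = \<phi> (\<lambda>i. a (s i), inv' s) y"
      by (subst action_mult[OF t vector_in_carrier[OF a]]) (simp add: inv)
    also have "\<dots> = \<phi> (\<lambda>i. a (s i), id) (\<phi> ?t y)"
      by (subst action_mult[OF vector_in_carrier[OF b] t]) simp
    finally show ?thesis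
      using f b action_in_range[OF t y]
      by (simp add: g_def weight_function_def sign_char_image[OF s])
  qed
  then have "weight_function (s ` S) g" by (simp add: weight_function_def)
  moreover obtain y where "y \<in> {1..m}" "x = \<phi> ?t y"
    using permutes_image[OF action_permutes[OF t]] x(1) by blast
  ultimately have "\<exists>g. weight_function (s ` S) g \<and> (\<exists>x\<in>{1..m}. g x \<noteq> 0)"
    using x(2) unfolding g_def by blast
  then show ?thesis
    using sub permutes_image[OF s] unfolding weight_def by blast
qed

lemma weight_of_same_card:
  assumes "weight S" "T \<subseteq> {1..n}" "card T = card S"
  shows "weight T"
proof -
  have "S \<subseteq> {1..n}" using assms(1) by (simp add: weight_def)
  then obtain s where "s permutes {1..n}" "s ` S = T"
    using ex_permutes_image_eq[of "{1..n}" S T] assms by auto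
  with weight_image assms(1) show ?thesis by blast
qed

text \<open>
  A vector with character value \<open>-1\<close> permutes the points and negates the sum.
\<close>
lemma sum_weight_function_eq_0:
  assumes f: "weight_function S f" and S: "S \<subseteq> {1..n}" "S \<noteq> {}" "S \<noteq> {1..n}"
  shows "(\<Sum>x\<in>{1..m}. f x) = 0"
proof -
  obtain a where a: "a \<in> carrier (even_vectors n)" "sign_char S a = -1"
    using sign_char_nontrivial[OF S] .
  have "(\<Sum>x\<in>{1..m}. f x) = (\<Sum>x\<in>{1..m}. f (\<phi> (a, id) x))"
    using sum.permute[OF action_permutes[OF vector_in_carrier[OF a(1)]], of f] by (simp add: comp_def)
  also have "\<dots> = - (\<Sum>x\<in>{1..m}. f x)"
    using f a by (simp add: weight_function_def sum_negf)
  finally show ?thesis by simp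
qed

text \<open>
  The product of eigenfunctions for \<open>S\<close> and \<open>T\<close> is one for their symmetric difference, which is
  neither empty nor full, so it sums to \<open>0\<close>: distinct characters have orthogonal
  eigenfunctions.
\<close>
lemma card_weights_le:
  assumes wt: "\<And>S. S \<in> I \<Longrightarrow> weight S"
    and compl: "\<And>S T. S \<in> I \<Longrightarrow> T \<in> I \<Longrightarrow> T \<noteq> {1..n} - S"
  shows "card I \<le> m"
proof -
  have sub: "S \<subseteq> {1..n}" if "S \<in> I" for S using wt[OF that] by (simp add: weight_def)
  then have fin: "finite I" by (intro finite_subset[of I "Pow {1..n}"]) auto
  have "\<exists>f. weight_function S f \<and> (\<exists>x\<in>{1..m}. f x \<noteq> 0)" if "S \<in> I" for S
    using wt[OF that] by (simp add: weight_def)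
  then obtain f where f: "weight_function S (f S)" "\<exists>x\<in>{1..m}. f S x \<noteq> 0" if "S \<in> I" for S
    by metis
  have "(\<Sum>x\<in>{1..m}. f S x * f T x) = 0" if ST: "S \<in> I" "T \<in> I" "S \<noteq> T" for S T
  proof (rule sum_weight_function_eq_0)
    show "weight_function (sym_diff S T) (\<lambda>x. f S x * f T x)"
      using ST f finite_subset[OF sub] by (intro weight_function_mult) auto
    show "sym_diff S T \<subseteq> {1..n}" using sub[OF ST(1)] sub[OF ST(2)] by blast
    show "sym_diff S T \<noteq> {}" using ST(3) by blast
    show "sym_diff S T \<noteq> {1..n}" using compl[OF ST(1,2)] sub[OF ST(1)] sub[OF ST(2)] by blast
  qed
  then have "card I \<le> card {1..m}"
    using card_orthogonal_family_le[of I "{1..m}" f] f fin by blast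
  then show ?thesis by simp
qed

lemma card_support_weight_function:
  assumes f: "weight_function S f" and x: "x \<in> {1..m}" "f x \<noteq> 0"
    and S: "S \<subseteq> {1..n}" "S \<noteq> {}" "S \<noteq> {1..n}"
  shows "2 \<le> card {y \<in> {1..m}. f y \<noteq> 0}"
proof -
  obtain a where a: "a \<in> carrier (even_vectors n)" "sign_char S a = -1"
    using sign_char_nontrivial[OF S] .
  let ?y = "\<phi> (a, id) x"
  have y: "?y \<in> {1..m}" using x(1) by (rule action_in_range[OF vector_in_carrier[OF a(1)]])
  have "f ?y = - f x" using f a x(1) by (simp add: weight_function_def)
  with x(2) have "f ?y \<noteq> 0" "?y \<noteq> x" by auto
  have "card {x, ?y} \<le> card {y \<in> {1..m}. f y \<noteq> 0}"
    using \<open>f ?y \<noteq> 0\<close> x y by (intro card_mono) auto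
  with \<open>?y \<noteq> x\<close> show ?thesis by simp
qed

text \<open>
  Let \<open>u \<in> U\<close> move \<open>w\<close> to \<open>x \<noteq> w\<close>. By Fourier inversion on \<open>U\<close>, the indicator function of \<open>w\<close>
  times \<open>2^n\<close> is the sum over all \<open>S\<close> of eigenfunctions \<open>F S\<close>. It vanishes at \<open>x\<close>, whereas the two
  sets with trivial character contribute a positive amount there: each counts the vectors
  that move \<open>w\<close> to \<open>x\<close>, and \<open>u\<close> is one of them. Hence some other \<open>F S\<close> is nonzero at \<open>x\<close>.
\<close>
lemma ex_nontrivial_weight:
  assumes "inj_on \<phi> (carrier (coxeter_D n))" "n \<ge> 3"
  obtains S where "weight S" "S \<noteq> {}" "S \<noteq> {1..n}"
proof -
  let ?U = "carrier (even_vectors n)"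
  have finU: "finite ?U"
    using card_even_vectors[of n] assms(2) by (intro card_ge_0_finite) simp
  define u :: "nat \<Rightarrow> bit" where "u = (\<lambda>k. if k \<in> {1, 2} then 1 else 0)"
  have u: "u \<in> ?U" unfolding u_def by (rule pair_in_even_vectors) (use assms(2) in auto)
  have "u 1 \<noteq> 0" by (simp add: u_def)
  then have "u \<noteq> (\<lambda>i. 0)" by metis
  then have "\<phi> (u, id) \<noteq> \<phi> (\<lambda>i. 0, id)"
    using inj_onD[OF assms(1), of "(u, id)" "(\<lambda>i. 0, id)"] u vector_in_carrier by auto
  then obtain w where w: "\<phi> (u, id) w \<noteq> w" by (auto simp: action_one fun_eq_iff)
  then have wm: "w \<in> {1..m}"
    using permutes_not_in[OF action_permutes[OF vector_in_carrier[OF u]]] by blast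
  define x where "x = \<phi> (u, id) w"
  have xm: "x \<in> {1..m}" unfolding x_def
    using wm by (rule action_in_range[OF vector_in_carrier[OF u]])
  define F where "F S y = (\<Sum>a\<in>?U. if \<phi> (a, id) w = y then sign_char S a else 0)" for S y
  have F: "weight_function S (F S)" for S
    unfolding weight_function_def
  proof (intro ballI)
    fix b y assume b: "b \<in> ?U" and y: "y \<in> {1..m}"
    have bb: "\<phi> (b, id) (\<phi> (b, id) z) = z" for z
      using vector_action_add[OF b b] by (simp add: action_one)
    have iff: "\<phi> (\<lambda>i. a i + b i, id) w = \<phi> (b, id) y \<longleftrightarrow> \<phi> (a, id) w = y" if a: "a \<in> ?U" for a
      using vector_action_add[OF b a, of w] bb by (metis (no_types, lifting) add.commute ext)
    have "F S (\<phi> (b, id) y) = (\<Sum>a\<in>?U. if \<phi> (\<lambda>i. a i + b i, id) w = \<phi> (b, id) y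
        then sign_char S (\<lambda>i. a i + b i) else 0)"
      unfolding F_def
    proof (rule sum.reindex_bij_betw[symmetric])
      have "(\<lambda>i. a i + b i + b i) = a" for a :: "nat \<Rightarrow> bit"
        by (simp add: fun_eq_iff add.assoc)
      then show "bij_betw (\<lambda>a i. a i + b i) ?U ?U"
        using b by (intro bij_betw_byWitness[where f' = "\<lambda>a i. a i + b i"])
          (auto intro: even_vectors_add)
    qed
    also have "\<dots> = (\<Sum>a\<in>?U. sign_char S b * (if \<phi> (a, id) w = y then sign_char S a else 0))"
      by (intro sum.cong refl) (simp add: iff sign_char_add)
    also have "\<dots> = sign_char S b * F S y" by (simp add: F_def sum_distrib_left)
    finally show "F S (\<phi> (b, id) y) = sign_char S b * F S y" .
  qed
  have "(\<Sum>S\<in>Pow {1..n}. F S x) =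
      (\<Sum>a\<in>?U. \<Sum>S\<in>Pow {1..n}. if \<phi> (a, id) w = x then sign_char S a else 0)"
    unfolding F_def by (rule sum.swap)
  also have "\<dots> = (\<Sum>a\<in>?U. if \<phi> (a, id) w = x then \<Sum>S\<in>Pow {1..n}. sign_char S a else 0)"
    by (intro sum.cong) auto
  also have "\<dots> = 0"
  proof (rule sum.neutral, rule ballI)
    fix a assume a: "a \<in> ?U"
    have "a \<noteq> (\<lambda>i. 0)" if "\<phi> (a, id) w = x"
      using that w by (auto simp: x_def action_one)
    then show "(if \<phi> (a, id) w = x then \<Sum>S\<in>Pow {1..n}. sign_char S a else 0) = 0"
      using sum_sign_char[OF a] by auto
  qed
  finally have total: "(\<Sum>S\<in>Pow {1..n}. F S x) = 0" .
  have F0: "F {} x > 0"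
    unfolding F_def using u
    by (intro sum_pos2[where i = u]) (auto simp: x_def sign_char_def finU)
  have F1: "F {1..n} x \<ge> 0"
    unfolding F_def by (intro sum_nonneg) (simp add: sign_char_top del: One_nat_def)
  have "\<exists>S\<in>Pow {1..n} - {{}, {1..n}}. F S x \<noteq> 0"
  proof (rule ccontr)
    assume "\<not> ?thesis"
    then have "(\<Sum>S\<in>Pow {1..n} - {{}, {1..n}}. F S x) = 0" by simp
    moreover have "(\<Sum>S\<in>Pow {1..n}. F S x) =
        (\<Sum>S\<in>Pow {1..n} - {{}, {1..n}}. F S x) + (\<Sum>S\<in>{{}, {1..n}}. F S x)"
      by (rule sum.subset_diff) auto
    ultimately show False using total F0 F1 assms(2) by simp
  qed
  then obtain S where S: "S \<subseteq> {1..n}" "S \<noteq> {}" "S \<noteq> {1..n}" "F S x \<noteq> 0" by blast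
  then have "weight S" unfolding weight_def using F xm by blast
  with S show thesis by (intro that)
qed

text \<open>
  The bound \<open>n \<ge> 5\<close> enters twice: the complement of a pair is no pair, and there are
  \<open>n (n - 1) / 2 \<ge> 2n\<close> pairs.
\<close>
lemma degree_ge_of_pair_weight:
  assumes "n \<ge> 5" "weight S" "card S = 2"
  shows "2 * n \<le> m"
proof -
  let ?I = "{T. T \<subseteq> {1..n} \<and> card T = 2}"
  have "card ({1..n} - T) \<noteq> 2" if "T \<in> ?I" for T
    using that assms(1) finite_subset[of T "{1..n}"] by (auto simp: card_Diff_subset)
  then have "card ?I \<le> m"
    using weight_of_same_card[OF assms(2)] assms(3) by (intro card_weights_le) auto
  moreover have "card ?I = n choose 2" using n_subsets[of "{1..n}" 2] by simp
  moreover have "2 * n \<le> n choose 2"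
  proof -
    have "n * 4 \<le> n * (n - 1)" using assms(1) by (intro mult_le_mono) auto
    then show ?thesis unfolding choose_two by linarith
  qed
  ultimately show ?thesis by simp
qed

text \<open>
  Keeping only the sets that contain \<open>1\<close> rules out complementary ones also when
  \<open>2 * card S = n\<close>. Their number is at least \<open>(n - 1) choose 2\<close>, which reaches \<open>2n\<close> from \<open>n = 7\<close> on;
  for \<open>n = 6\<close> it is only \<open>10\<close>.
\<close>
lemma degree_ge_of_large_weight:
  assumes "n \<ge> 7" "weight S" "3 \<le> card S" "2 * card S \<le> n"
  shows "2 * n \<le> m"
proof -
  let ?J = "{T. T \<subseteq> {2..n} \<and> card T = card S - 1}"
  have J: "1 \<notin> T" "finite T" "T \<subseteq> {1..n}" if "T \<in> ?J" for T
    using that finite_subset[of T "{2..n}"] by auto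
  have "inj_on (insert 1) ?J"
    using J(1) by (intro inj_onI) (meson insert_ident)
  then have "card (insert 1 ` ?J) = (n - 1) choose (card S - 1)"
    using n_subsets[of "{2..n}" "card S - 1"] by (simp add: card_image)
  moreover have "card (insert 1 ` ?J) \<le> m"
  proof (rule card_weights_le)
    fix T assume "T \<in> insert 1 ` ?J"
    then obtain T0 where T: "T = insert 1 T0" and T0: "T0 \<in> ?J" by blast
    have "T \<subseteq> {1..n}" using J(3)[OF T0] assms(1) by (simp add: T)
    moreover have "card T = card S" using J(1,2)[OF T0] T0 assms(3) by (simp add: T)
    ultimately show "weight T" by (rule weight_of_same_card[OF assms(2)])
  next
    fix T T' assume "T \<in> insert 1 ` ?J" "T' \<in> insert 1 ` ?J"
    then have "1 \<in> T" "1 \<in> T'" by blast+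
    then show "T' \<noteq> {1..n} - T" by blast
  qed
  moreover have "(n - 1) choose 2 \<le> (n - 1) choose (card S - 1)"
    using assms by (intro binomial_mono) auto
  moreover have "2 * n \<le> (n - 1) choose 2"
  proof -
    obtain k where k: "n = k + 7" using assms(1) by (metis add.commute le_Suc_ex)
    have "4 * n \<le> (n - 1) * (n - 2)" by (simp add: k algebra_simps)
    moreover have "n - 1 - 1 = n - 2" by simp
    ultimately show ?thesis by (simp add: choose_two)
  qed
  ultimately show ?thesis by linarith
qed

text \<open>
  Orthogonality alone gives only \<open>n \<le> m\<close> here. The missing factor \<open>2\<close> comes from the supports,
  which are disjoint unless a product of two eigenfunctions makes a pair a weight.
\<close>
lemma degree_ge_of_singleton_weight:
  assumes n: "n \<ge> 5" and S: "weight S" "card S = 1"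
  shows "2 * n \<le> m"
proof -
  have "weight {i}" if "i \<in> {1..n}" for i
    using that S by (intro weight_of_same_card[OF S(1)]) auto
  then have "\<exists>f. weight_function {i} f \<and> (\<exists>x\<in>{1..m}. f x \<noteq> 0)" if "i \<in> {1..n}" for i
    using that unfolding weight_def by blast
  then obtain f where f: "weight_function {i} (f i)" "\<exists>x\<in>{1..m}. f i x \<noteq> 0" if "i \<in> {1..n}" for i
    by metis
  define supp where "supp i = {x \<in> {1..m}. f i x \<noteq> 0}" for i
  show ?thesis
  proof (cases "\<exists>i\<in>{1..n}. \<exists>j\<in>{1..n}. i \<noteq> j \<and> supp i \<inter> supp j \<noteq> {}")
    case True
    then obtain i j x where ij: "i \<in> {1..n}" "j \<in> {1..n}" "i \<noteq> j"
      and "x \<in> supp i" "x \<in> supp j" by blast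
    then have x: "x \<in> {1..m}" "f i x * f j x \<noteq> 0" by (auto simp: supp_def)
    have "sym_diff {i} {j} = {i, j}" using ij by auto
    with weight_function_mult[OF f(1)[OF ij(1)] f(1)[OF ij(2)]]
    have "weight_function {i, j} (\<lambda>x. f i x * f j x)" by simp
    with x ij have "weight {i, j}" unfolding weight_def by blast
    with ij n show ?thesis by (intro degree_ge_of_pair_weight[of "{i, j}"]) auto
  next
    case False
    have two: "2 \<le> card (supp i)" if i: "i \<in> {1..n}" for i
    proof -
      have "{i} \<noteq> {1..n}"
      proof
        assume "{i} = {1..n}"
        then have "card {i} = card {1..n}" by (rule arg_cong)
        with n show False by simp
      qed
      with i f[OF i] show ?thesis
        unfolding supp_def by (blast intro: card_support_weight_function[where S = "{i}"])
    qed
    have "2 * n = (\<Sum>i\<in>{1..n}. 2)" by simp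
    also have "\<dots> \<le> (\<Sum>i\<in>{1..n}. card (supp i))" by (rule sum_mono) (rule two)
    also have "\<dots> = card (\<Union>i\<in>{1..n}. supp i)"
      using False by (subst card_UN_disjoint) (auto simp: supp_def)
    also have "\<dots> \<le> card {1..m}" by (rule card_mono) (auto simp: supp_def)
    finally show ?thesis by simp
  qed
qed

lemma degree_ge:
  assumes "inj_on \<phi> (carrier (coxeter_D n))" "n = 5 \<or> n \<ge> 7"
  shows "2 * n \<le> m"
proof -
  have "n \<ge> 3" using assms(2) by auto
  then obtain S0 where S0: "weight S0" "S0 \<noteq> {}" "S0 \<noteq> {1..n}"
    by (rule ex_nontrivial_weight[OF assms(1)])
  obtain S where S: "weight S" "S \<noteq> {}" "2 * card S \<le> n"
  proof (cases "2 * card S0 \<le> n")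
    case False
    have "S0 \<subseteq> {1..n}" using S0(1) by (simp add: weight_def)
    then have "card ({1..n} - S0) = n - card S0" "{1..n} - S0 \<noteq> {}"
      using S0(3) finite_subset[of S0 "{1..n}"] by (auto simp: card_Diff_subset)
    then show thesis using that[of "{1..n} - S0"] weight_compl[OF S0(1)] False by auto
  qed (use S0 that in auto)
  have "finite S" using S(1) finite_subset[of S "{1..n}"] by (simp add: weight_def)
  then have "card S \<noteq> 0" using S(2) by simp
  then consider "card S = 1" | "card S = 2" | "3 \<le> card S" by linarith
  then show ?thesis
  proof cases
    case 1
    then show ?thesis using degree_ge_of_singleton_weight[OF _ S(1)] assms(2) by auto
  next
    case 2
    then show ?thesis using degree_ge_of_pair_weight[OF _ S(1)] assms(2) by auto
  next
    case 3
    then show ?thesis using degree_ge_of_large_weight[OF _ S(1)] S(3) assms(2) by auto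
  qed
qed

end

section \<open>The minimal degree\<close>

lemma order_dvd_fact_of_embedding:
  assumes "group G" "h \<in> mon G (sym_group m)"
  shows "order G dvd fact m"
proof -
  interpret group_hom G "sym_group m" h
    using assms sym_group_is_group by (auto simp: group_hom_def group_hom_axioms_def mon_def)
  have "card (h ` carrier G) dvd order (sym_group m)"
    using H.lagrange[OF img_is_subgroup] by (metis dvd_triv_right)
  moreover have "card (h ` carrier G) = order G"
    using assms(2) by (simp add: mon_def card_image order_def)
  ultimately show ?thesis using sym_group_card_carrier[of m] by (simp add: order_def)
qed

theorem theorem3p3:
  fixes n :: nat
  assumes "n \<ge> 4"
  shows "min_faithful_perm_degree (coxeter_D n) = 2 * n"
  unfolding min_faithful_perm_degree_def
proof (rule Least_equality)
  show "mon (coxeter_D n) (sym_group (2 * n)) \<noteq> {}"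
    using signed_perm_mon by blast
next
  fix m assume "mon (coxeter_D n) (sym_group m) \<noteq> {}"
  then obtain \<phi> where \<phi>: "\<phi> \<in> mon (coxeter_D n) (sym_group m)" by blast
  then interpret coxeter_D_action n m \<phi>
    by unfold_locales (simp add: mon_def)
  show "2 * n \<le> m"
  proof (cases "n = 5 \<or> n \<ge> 7")
    case True
    then show ?thesis using degree_ge \<phi> by (simp add: mon_def)
  next
    case False
    with assms have n: "n = 4 \<or> n = 6" by auto
    show ?thesis
    proof (rule ccontr)
      assume "\<not> 2 * n \<le> m"
      then have "(fact m :: nat) dvd fact (2 * n - 1)" by (intro fact_dvd) simp
      then have "2 ^ (n - 1) * fact n dvd (fact (2 * n - 1) :: nat)"
        using order_dvd_fact_of_embedding[OF group_coxeter_D \<phi>] order_coxeter_D[of n] assms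
        by (metis dvd_trans le_trans one_le_numeral)
      then show False using n by (auto simp: fact_numeral)
    qed
  qed
qed

end
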